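(* Let $b$ be a real number with $e < b$, where $e$ is the base of the natural logarithm. Then $b^{e} < e^{b}$.
   Context: Here $e = \exp(1)$ is Euler's number, and the powers are real powers of positive real numbers. *)

theory Defs imports Complex_Main begin

end

theory Submission imports Defs begin

text \<open>
  The line tangent to the logarithm at \<open>1\<close> lies strictly above its graph elsewhere. Rescaling by
  \<open>e\<close> moves the point of tangency to \<open>e\<close>, where the tangent \<open>y = x / e\<close> passes through the origin.
  Hence \<open>ln b < b / e\<close>, which is the claim after taking logarithms.
\<close>

theorem mainTheorem1:
  fixes b :: real
  assumes "exp 1 < b"
  shows "b powr exp 1 < exp 1 powr b"
proof -
  have "0 < b"
    using assms exp_gt_zero [of "1 :: real"] by linarith
  then have "0 < b / exp 1" and "b / exp 1 \<noteq> 1"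
    using assms by auto
  then have "ln (b / exp 1) < b / exp 1 - 1"
    using ln_le_minus_one ln_eq_minus_one by (metis order_le_less)
  then have "ln b < b / exp 1"
    using \<open>0 < b\<close> by (simp add: ln_div)
  then have "exp 1 * ln b < b"
    by (simp add: field_simps)
  then show ?thesis
    using \<open>0 < b\<close> by (simp add: powr_def)
qed

end
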